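(* Let $\Omega\subseteq\mathbb{C}^n$ be a domain and let $f_1,f_2\colon\Omega\to\mathbb{C}$ be holomorphic functions which coincide on a nonempty open subset $U\subseteq\Omega$. Then $f_1=f_2$ on the whole of $\Omega$.
   Context: A domain in $\mathbb{C}^n$ is an open and path-connected subset. A function on an open subset of $\mathbb{C}^n$ is holomorphic if it is continuous and holomorphic in each variable separately. *)

theory Defs
  imports "HOL-Analysis.Analysis"
begin

definition complex_domain :: "(complex ^ 'n::finite) set \<Rightarrow> bool" where
  "complex_domain S \<longleftrightarrow> open S \<and> path_connected S"

definition vec_upd :: "'a ^ 'n::finite \<Rightarrow> 'n \<Rightarrow> 'a \<Rightarrow> 'a ^ 'n" where
  "vec_upd z i w = (\<chi> j. if j = i then w else z $ j)"

(* Intended for open S. Functions are total, and only their values on S matter: the i-th slice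
   through a point z of S is considered only at those w for which the modified point is in S. *)
definition several_holomorphic_on ::
  "(complex ^ 'n::finite \<Rightarrow> complex) \<Rightarrow> (complex ^ 'n) set \<Rightarrow> bool" where
  "several_holomorphic_on f S \<longleftrightarrow>
     continuous_on S f \<and>
     (\<forall>z\<in>S. \<forall>i. (\<lambda>w. f (vec_upd z i w)) holomorphic_on {w. vec_upd z i w \<in> S})"

end

theory Submission
  imports Defs "HOL-Complex_Analysis.Conformal_Mappings"
begin

text \<open>
  The interior \<open>W\<close> of the coincidence set of the two functions is open and nonempty, so by
  connectedness of the domain it suffices that its complement in the domain is open. This is local:
  every point of the domain has a neighbourhood \<open>P\<close> inside the domain that is a product of connected
  open subsets of the complex plane. If \<open>P\<close> meets \<open>W\<close>, then the functions agree on a smaller product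
  inside \<open>P\<close>, and the one-variable identity theorem, applied to one coordinate after another,
  enlarges the factors of the smaller product to those of \<open>P\<close> (\<open>eq_on_box_of_eq_on_open\<close>). Hence \<open>P\<close>
  lies entirely in \<open>W\<close>.
\<close>

lemma holomorphic_on_slice:
  assumes "several_holomorphic_on f S" "u \<in> S" "\<And>t. t \<in> T \<Longrightarrow> vec_upd u i t \<in> S"
  shows "(\<lambda>t. f (vec_upd u i t)) holomorphic_on T"
  using assms unfolding several_holomorphic_on_def
  by (blast intro: holomorphic_on_subset)

lemma vec_upd_triv: "vec_upd u i (u $ i) = u"
  by (simp add: vec_upd_def vec_eq_iff)

text \<open>The factors \<open>B i\<close> are enlarged to \<open>A i\<close> for the indices in \<open>I\<close>, by induction on \<open>I\<close>.\<close>

lemma eq_on_mixed_box: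
  fixes f g :: "complex ^ 'n::finite \<Rightarrow> complex" and A B :: "'n \<Rightarrow> complex set"
  assumes f: "several_holomorphic_on f S" and g: "several_holomorphic_on g S"
    and A: "\<And>i. open (A i)" "\<And>i. connected (A i)"
    and B: "\<And>i. open (B i)" "\<And>i. B i \<noteq> {}" "\<And>i. B i \<subseteq> A i"
    and sub: "{u. \<forall>i. u $ i \<in> A i} \<subseteq> S"
    and eq: "\<And>u. (\<And>i. u $ i \<in> B i) \<Longrightarrow> f u = g u"
    and "finite I"
  shows "(\<And>i. u $ i \<in> (if i \<in> I then A i else B i)) \<Longrightarrow> f u = g u"
  using \<open>finite I\<close>
proof (induction I arbitrary: u rule: finite_induct)
  case empty
  then show ?case using eq by simp
next
  case (insert k I)
  have uA: "u $ i \<in> A i" for i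
    using insert.prems[of i] B(3)[of i] by (auto split: if_splits)
  have slice: "vec_upd u k t \<in> S" if "t \<in> A k" for t
    using uA that sub by (auto simp: vec_upd_def)
  have uS: "u \<in> S" using uA sub by blast
  have "f (vec_upd u k (u $ k)) = g (vec_upd u k (u $ k))"
  proof (rule analytic_continuation_open[where s = "B k" and s' = "A k" and z = "u $ k"
        and f = "\<lambda>t. f (vec_upd u k t)" and g = "\<lambda>t. g (vec_upd u k t)"])
    show "(\<lambda>t. f (vec_upd u k t)) holomorphic_on A k"
      by (rule holomorphic_on_slice[OF f uS slice])
    show "(\<lambda>t. g (vec_upd u k t)) holomorphic_on A k"
      by (rule holomorphic_on_slice[OF g uS slice])
    show "f (vec_upd u k t) = g (vec_upd u k t)" if "t \<in> B k" for t
    proof (rule insert.IH)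
      show "vec_upd u k t $ i \<in> (if i \<in> I then A i else B i)" for i
        using insert.prems[of i] insert.hyps that by (auto simp: vec_upd_def)
    qed
  qed (use A B uA in auto)
  then show ?case by (simp add: vec_upd_triv)
qed

lemma eq_on_box_of_eq_on_open:
  fixes f g :: "complex ^ 'n::finite \<Rightarrow> complex" and A :: "'n \<Rightarrow> complex set"
  assumes f: "several_holomorphic_on f S" and g: "several_holomorphic_on g S"
    and A: "\<And>i. open (A i)" "\<And>i. connected (A i)"
    and sub: "{u. \<forall>i. u $ i \<in> A i} \<subseteq> S"
    and V: "open V" "\<And>v. v \<in> V \<Longrightarrow> f v = g v"
    and w: "w \<in> V" "\<And>i. w $ i \<in> A i"
    and u: "\<And>i. u $ i \<in> A i"
  shows "f u = g u"
proof -
  obtain B where B: "\<And>i. open (B i)" "\<And>i. w $ i \<in> B i" "\<And>y. (\<forall>i. y $ i \<in> B i) \<Longrightarrow> y \<in> V"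
    using V(1) w(1) unfolding open_vec_def by meson
  show ?thesis
  proof (rule eq_on_mixed_box[OF f g A, where B = "\<lambda>i. A i \<inter> B i" and I = UNIV])
    show "A i \<inter> B i \<noteq> {}" for i using w(2) B(2) by blast
  qed (use A B V sub u in auto)
qed

theorem theorem4:
  fixes \<Omega> U :: "(complex ^ 'n::finite) set"
    and f\<^sub>1 f\<^sub>2 :: "complex ^ 'n \<Rightarrow> complex"
  assumes "complex_domain \<Omega>"
    and "several_holomorphic_on f\<^sub>1 \<Omega>"
    and "several_holomorphic_on f\<^sub>2 \<Omega>"
    and "open U" and "U \<noteq> {}" and "U \<subseteq> \<Omega>"
    and "\<And>z. z \<in> U \<Longrightarrow> f\<^sub>1 z = f\<^sub>2 z"
  shows "\<forall>z\<in>\<Omega>. f\<^sub>1 z = f\<^sub>2 z"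
proof -
  define W where "W = interior {z \<in> \<Omega>. f\<^sub>1 z = f\<^sub>2 z}"
  have \<Omega>: "open \<Omega>" "connected \<Omega>"
    using assms(1) by (auto simp: complex_domain_def path_connected_imp_connected)
  have W: "open W" "W \<subseteq> \<Omega>" "\<And>z. z \<in> W \<Longrightarrow> f\<^sub>1 z = f\<^sub>2 z"
    using interior_subset unfolding W_def by blast+
  have UW: "U \<subseteq> W"
    unfolding W_def using assms(4,6,7) by (intro interior_maximal) auto
  have "open (\<Omega> - W)"
  proof (subst open_subopen, intro ballI)
    fix z assume z: "z \<in> \<Omega> - W"
    then obtain A where A: "\<And>i. open (A i)" "\<And>i. z $ i \<in> A i"
        "\<And>y. (\<forall>i. y $ i \<in> A i) \<Longrightarrow> y \<in> \<Omega>"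
      using \<Omega>(1) unfolding open_vec_def by (meson DiffD1)
    \<comment> \<open>The factors of a basic open box need not be connected; passing to the components that
      contain the coordinates of \<open>z\<close> makes them so and keeps them open.\<close>
    define C where "C i = connected_component_set (A i) (z $ i)" for i
    have C: "open (C i)" "connected (C i)" "z $ i \<in> C i" "C i \<subseteq> A i" for i
      using A(1,2)[of i]
      by (auto simp: C_def open_connected_component connected_component_refl_eq
          connected_component_subset)
    define P where "P = {u. \<forall>i. u $ i \<in> C i}"
    have P: "open P" "z \<in> P" "P \<subseteq> \<Omega>"
      using C A(3) unfolding P_def by (auto intro!: open_vector_box) blast
    have "P \<inter> W = {}"
    proof (rule ccontr)
      assume "P \<inter> W \<noteq> {}"
      then obtain w where w: "w \<in> W" "\<And>i. w $ i \<in> C i"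
        unfolding P_def by blast
      have "f\<^sub>1 u = f\<^sub>2 u" if "u \<in> P" for u
        using eq_on_box_of_eq_on_open[OF assms(2,3) C(1,2) P(3)[unfolded P_def] W(1,3) w, of u] that
        unfolding P_def by blast
      then have "P \<subseteq> W"
        unfolding W_def using P by (intro interior_maximal) auto
      then show False using z P(2) by blast
    qed
    then show "\<exists>T. open T \<and> z \<in> T \<and> T \<subseteq> \<Omega> - W"
      using P by blast
  qed
  then have "\<Omega> - W = {}"
    using connectedD[OF \<Omega>(2) W(1), of "\<Omega> - W"] UW assms(5,6) by blast
  then show ?thesis using W(3) by blast
qed

end
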